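(* For every $a\in(0,\pi]$, the domain $G_a$ satisfies $b(G_a)=\frac{\pi}{2a}$.
   Context: For $a\in(0,\pi)$ let $S_a=\{z\in\mathbb{C}:\ \mathrm{Re}\, z>|\mathrm{Im}\, z|\cot a\}$ (the open sector of angle $2a$ with vertex $0$, symmetric about $\mathbb{R}$ and containing $1$), let $E_a=(\mathbb{Z}+i\mathbb{Z})\setminus\overline{S_a}$, and let $G_a=\mathbb{C}\setminus E_a$. For $a=\pi$, let $G_\pi=\mathbb{C}\setminus\{-n: n\in\mathbb{N}\}$, where $\mathbb{N}=\{1,2,3,\dots\}$. Let $\mathbb{D}$ be the open unit disk, and for a domain $D\subset\mathbb{C}$ let $\mathrm{Hol}(\mathbb{D},D)$ be the set of holomorphic functions $f:\mathbb{D}\to D$. For $p>0$ and $\alpha>-1$, the weighted Bergman space $A^p_\alpha$ is the set of holomorphic $f$ on $\mathbb{D}$ with $\int_{\mathbb{D}}|f(z)|^p(1-|z|)^\alpha\,dA(z)<+\infty$, where $dA$ is Lebesgue area measure. The Bergman number of a holomorphic function $f$ on $\mathbb{D}$ is $b(f):=\sup\left(\left\{\frac{p}{\alpha+2}: p>0,\ \alpha>-1,\ f\in A^p_\alpha\right\}\cup\{0\}\right)\in[0,+\infty]$. The Bergman number of a domain $D$ is $b(D):=\inf\{b(f): f\in\mathrm{Hol}(\mathbb{D},D)\}\in[0,+\infty]$. *)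

theory Defs
  imports "HOL-Complex_Analysis.Complex_Analysis"
begin

definition sector :: "real \<Rightarrow> complex set" where
  "sector a = {z. Re z > \<bar>Im z\<bar> * cot a}"

definition gauss_lattice :: "complex set" where
  "gauss_lattice = {Complex (of_int m) (of_int n) | m n :: int. True}"

definition E_set :: "real \<Rightarrow> complex set" where
  "E_set a = gauss_lattice - closure (sector a)"

text \<open>The case \<open>a = pi\<close> is separate: there \<open>cot\<close> has a pole (and HOL's total \<open>cot\<close> takes the
  value 0), so the sector formula does not apply. Only \<open>0 < a \<le> pi\<close> is meaningful.\<close>

definition G_dom :: "real \<Rightarrow> complex set" where
  "G_dom a = (if a = pi then UNIV - {- of_nat n | n :: nat. n \<ge> 1} else UNIV - E_set a)"

text \<open>Functions on the unit disc are total functions \<open>complex \<Rightarrow> complex\<close> of which only the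
  values on \<open>ball 0 1\<close> matter in all definitions below.\<close>

definition Hol_disc :: "complex set \<Rightarrow> (complex \<Rightarrow> complex) set" where
  "Hol_disc D = {f. f holomorphic_on ball 0 1 \<and> f ` ball 0 1 \<subseteq> D}"

definition bergman_space :: "real \<Rightarrow> real \<Rightarrow> (complex \<Rightarrow> complex) set" where
  "bergman_space p \<alpha> = {f. f holomorphic_on ball 0 1 \<and>
     (\<integral>\<^sup>+ z \<in> ball 0 1. ennreal (cmod (f z) powr p * (1 - cmod z) powr \<alpha>) \<partial>lborel) < \<infinity>}"

definition bergman_number :: "(complex \<Rightarrow> complex) \<Rightarrow> ereal" where
  "bergman_number f =
     Sup ({ereal (p / (\<alpha> + 2)) | p \<alpha>. p > 0 \<and> \<alpha> > -1 \<and> f \<in> bergman_space p \<alpha>} \<union> {0})"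

definition domain_bergman_number :: "complex set \<Rightarrow> ereal" where
  "domain_bergman_number D = Inf {bergman_number f | f. f \<in> Hol_disc D}"

end

theory Submission
  imports Defs
begin

text \<open>
  The upper bound is attained by \<open>f(z) = (1 - z)\<^sup>-\<^sup>k\<close> with \<open>k = 2a/\<pi>\<close>, which maps the disc into the
  sector.  For the lower bound, every \<open>c > 4a/\<pi>\<close> admits an \<open>R\<close> such that all holomorphic
  \<open>f : D \<rightarrow> G\<^sub>a\<close> satisfy the Bloch-type estimate \<open>(1 - |z|\<^sup>2) |f'(z)| \<le> c |f(z)|\<close> wherever \<open>|f(z)| \<ge> R\<close>.
  Otherwise, after a Moebius shift there are \<open>f\<^sub>n\<close> with \<open>|f\<^sub>n(0)| \<rightarrow> \<infinity>\<close> violating it at \<open>0\<close>.  The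
  functions \<open>f\<^sub>n / |f\<^sub>n(0)|\<close> omit rescaled lattices that become dense outside the sector, so by
  Schottky, Montel and Hurwitz a subsequence has a limit with values in the sector, which
  contradicts Schwarz's lemma there.  Integrating the estimate along radii
  yields \<open>|f(z)| = O((1 - |z|)\<^sup>-\<^sup>c\<^sup>/\<^sup>2)\<close>, and then \<open>f \<in> A\<^sup>p\<^sub>\<alpha>\<close> for \<open>p = 2\<alpha>/c\<close>, where
  \<open>p/(\<alpha> + 2) \<rightarrow> 2/c\<close> as \<open>\<alpha> \<rightarrow> \<infinity>\<close>.
\<close>

subsection \<open>Schwarz estimates in half-planes and sectors\<close>

lemma deriv_le_of_Re_pos:
  assumes holg: "g holomorphic_on ball 0 1"
    and pos: "\<And>z. z \<in> ball 0 1 \<Longrightarrow> Re (g z) > 0"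
  shows "cmod (deriv g 0) \<le> 2 * Re (g 0)"
proof -
  \<comment> \<open>Schwarz's lemma for \<open>g\<close> followed by the Cayley transform of the half-plane\<close>
  define h where "h = (\<lambda>z. (g z - g 0) / (g z + cnj (g 0)))"
  have g0: "Re (g 0) > 0" using pos[of 0] by simp
  have nz: "g z + cnj (g 0) \<noteq> 0" if "z \<in> ball 0 1" for z
  proof
    assume "g z + cnj (g 0) = 0"
    then have "Re (g z) + Re (g 0) = 0" by (metis Re_complex_of_real complex_cnj_cnj plus_complex.sel(1) zero_complex.sel(1) cnj.sel(1))
    then show False using pos[OF that] g0 by linarith
  qed
  have holh: "h holomorphic_on ball 0 1"
    unfolding h_def using nz by (intro holomorphic_intros holg) auto
  have h1: "cmod (h z) < 1" if "cmod z < 1" for z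
  proof -
    have z: "z \<in> ball 0 1" using that by simp
    have "(cmod (g z - g 0))\<^sup>2 < (cmod (g z + cnj (g 0)))\<^sup>2"
      using mult_pos_pos[OF pos[OF z] g0]
      unfolding cmod_power2 by (simp add: algebra_simps power2_eq_square)
    then have "cmod (g z - g 0) < cmod (g z + cnj (g 0))"
      by (rule power_less_imp_less_base) simp
    then show ?thesis
      using nz[OF z] by (simp add: h_def norm_divide)
  qed
  have "cmod (deriv h 0) \<le> 1"
    by (rule Schwarz_Lemma(2)[OF holh _ h1, of 0]) (auto simp: h_def)
  moreover have "(h has_field_derivative deriv g 0 / (2 * Re (g 0))) (at 0)"
  proof -
    have dg: "(g has_field_derivative deriv g 0) (at 0)"
      using holg by (intro holomorphic_derivI[of g "ball 0 1"]) auto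
    have s: "g 0 + cnj (g 0) = 2 * Re (g 0)" by (simp add: complex_add_cnj)
    show ?thesis unfolding h_def
      by (rule derivative_eq_intros dg refl nz | use g0 in \<open>simp add: s\<close>)+
  qed
  ultimately have "cmod (deriv g 0 / (2 * Re (g 0))) \<le> 1"
    by (simp add: DERIV_imp_deriv)
  then show ?thesis using g0 by (simp add: norm_divide)
qed

text \<open>The power map with exponent \<open>k = pi / (2 * a)\<close> opens the sector onto the
  right half-plane, where the previous lemma applies. It multiplies the logarithmic derivative by
  \<open>k\<close>, so the bound 2 there becomes \<open>2 / k = 4 * a / pi\<close>.\<close>

lemma deriv_le_of_sector:
  assumes a: "0 < a" and holF: "F holomorphic_on ball 0 1"
    and slit: "\<And>z. z \<in> ball 0 1 \<Longrightarrow> F z \<notin> \<real>\<^sub>\<le>\<^sub>0"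
    and arg: "\<And>z. z \<in> ball 0 1 \<Longrightarrow> \<bar>Im (Ln (F z))\<bar> < a"
  shows "cmod (deriv F 0) \<le> 4 * a / pi * cmod (F 0)"
proof -
  define k where "k = pi / (2 * a)"
  have k: "k > 0" using a by (simp add: k_def)
  define g where "g = (\<lambda>z. exp (of_real k * Ln (F z)))"
  have holg: "g holomorphic_on ball 0 1"
    unfolding g_def using slit by (intro holomorphic_intros holF) auto
  have pos: "Re (g z) > 0" if "z \<in> ball 0 1" for z
  proof -
    have "\<bar>k * Im (Ln (F z))\<bar> < k * a"
      using arg[OF that] k by (simp add: abs_mult)
    also have "k * a = pi / 2" using a by (simp add: k_def)
    finally have "cos (k * Im (Ln (F z))) > 0"
      by (intro cos_gt_zero_pi) auto
    then show ?thesis by (simp add: g_def Re_exp)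
  qed
  have dF: "(F has_field_derivative deriv F 0) (at 0)"
    using holF by (intro holomorphic_derivI[of F "ball 0 1"]) auto
  have F0: "F 0 \<noteq> 0" "F 0 \<notin> \<real>\<^sub>\<le>\<^sub>0" using slit[of 0] by auto
  have "(g has_field_derivative g 0 * (k * (deriv F 0 / F 0))) (at 0)"
    unfolding g_def by (rule derivative_eq_intros dF refl F0 | simp add: field_simps)+
  then have "cmod (g 0 * (k * (deriv F 0 / F 0))) \<le> 2 * Re (g 0)"
    using deriv_le_of_Re_pos[OF holg pos] by (simp add: DERIV_imp_deriv)
  also have "\<dots> \<le> 2 * cmod (g 0)" by (simp add: complex_Re_le_cmod)
  finally have "cmod (g 0) * (k * (cmod (deriv F 0) / cmod (F 0))) \<le> cmod (g 0) * 2"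
    using k by (simp add: norm_mult norm_divide)
  moreover have "cmod (g 0) > 0" by (simp add: g_def)
  ultimately have "k * (cmod (deriv F 0) / cmod (F 0)) \<le> 2"
    by (metis mult_le_cancel_left_pos)
  then show ?thesis using F0 a by (simp add: k_def field_simps)
qed

subsection \<open>Growth along radii\<close>

text \<open>Along a radius the logarithm of the modulus has derivative at most
  \<open>c / (1 - t\<^sup>2)\<close>, which integrates to \<open>c / 2\<close> times the logarithm
  of \<open>(1 + t) / (1 - t)\<close>. The hypothesis holds only where \<open>f\<close> is large, so
  the integration starts at the last point where the modulus is at most \<open>M\<close>.\<close>

lemma growth_of_deriv_bound:
  assumes holf: "f holomorphic_on ball 0 1" and R: "R > 0" and c: "c > 0"
    and bd: "\<And>z. \<lbrakk>z \<in> ball 0 1; cmod (f z) \<ge> R\<rbrakk> \<Longrightarrow> (1 - (cmod z)\<^sup>2) * cmod (deriv f z) \<le> c * cmod (f z)"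
    and z: "z \<in> ball 0 1"
  shows "cmod (f z) \<le> max R (cmod (f 0)) * ((1 + cmod z) / (1 - cmod z)) powr (c / 2)"
proof -
  define M where "M = max R (cmod (f 0))"
  define r where "r = cmod z"
  \<comment> \<open>For \<open>z = 0\<close> this gives \<open>e = 0\<close>; arguing from
    \<open>cmod e \<le> 1\<close> covers that case too.\<close>
  define e where "e = sgn z"
  have r: "0 \<le> r" "r < 1" using z by (auto simp: r_def)
  have M: "M > 0" "M \<ge> R" "cmod (f 0) \<le> M" using R by (auto simp: M_def)
  have ze: "z = of_real r * e" by (simp add: r_def e_def sgn_eq)
  have e1: "cmod e \<le> 1" by (simp add: e_def norm_sgn)
  have inb: "of_real t * e \<in> ball 0 1" if "t \<in> {0..r}" for t :: real
  proof -
    have "cmod (of_real t * e) \<le> t * 1"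
      unfolding norm_mult using that e1 by (intro mult_mono) auto
    then show ?thesis using that r by auto
  qed
  have cont: "continuous_on {0..r} (\<lambda>t. cmod (f (of_real t * e)))"
    by (intro continuous_intros continuous_on_compose2[OF holomorphic_on_imp_continuous_on[OF holf]])
      (use inb in auto)
  define A where "A = {t \<in> {0..r}. cmod (f (of_real t * e)) \<le> M}"
  \<comment> \<open>\<open>t0\<close> is the last time on the radius at which \<open>f\<close> has modulus at most \<open>M\<close>;
    afterwards the derivative bound is available.\<close>
  have "0 \<in> A" using r M by (simp add: A_def)
  moreover have "compact A"
  proof -
    have "closed A" unfolding A_def
      using continuous_closed_preimage[OF cont closed_atLeastAtMost, of "{..M}"]
      by (simp add: vimage_def Int_def)
    moreover have "bounded A" by (rule bounded_subset[of "{0..r}"]) (auto simp: A_def)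
    ultimately show ?thesis by (simp add: compact_eq_bounded_closed)
  qed
  ultimately obtain t0 where t0: "t0 \<in> A" and mx: "\<And>t. t \<in> A \<Longrightarrow> t \<le> t0"
    using compact_attains_sup[of A] by blast
  have tr: "0 \<le> t0" "t0 \<le> r" and ft0: "cmod (f (of_real t0 * e)) \<le> M" using t0 by (auto simp: A_def)
  have big: "cmod (f (of_real t * e)) > M" if "t0 < t" "t \<le> r" for t
    using mx[of t] that tr by (force simp: A_def)
  show ?thesis
  proof (cases "t0 = r")
    case True
    then have "cmod (f z) \<le> M * 1" using ft0 ze by simp
    also have "\<dots> \<le> M * ((1 + r) / (1 - r)) powr (c / 2)"
      using M r c by (intro mult_left_mono ge_one_powr_ge_zero) (auto simp: field_simps)
    finally show ?thesis by (simp add: M_def r_def)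
  next
    case False
    then have tr': "t0 < r" using tr by simp
    \<comment> \<open>Twice the difference between the logarithm of the modulus and its claimed
      growth. Squaring the modulus makes it an inner product, which is easy to
      differentiate.\<close>
    define \<phi> where "\<phi> = (\<lambda>t. ln ((cmod (f (of_real t * e)))\<^sup>2) - c * (ln (1 + t) - ln (1 - t)))"
    \<comment> \<open>The modulus exceeds \<open>M\<close> immediately after \<open>t0\<close>, so
      continuity from the right gives equality. The derivative bound is then available at
      \<open>t0\<close> itself as well.\<close>
    have M': "cmod (f (of_real t0 * e)) = M"
    proof (rule antisym[OF ft0])
      have "((\<lambda>t. cmod (f (of_real t * e))) \<longlongrightarrow> cmod (f (of_real t0 * e))) (at t0 within {0..r})"
        using cont tr by (auto simp: continuous_on)
      then have "((\<lambda>t. cmod (f (of_real t * e))) \<longlongrightarrow> cmod (f (of_real t0 * e))) (at t0 within {t0..r})"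
        by (rule tendsto_within_subset) (use tr in auto)
      then have *: "((\<lambda>t. cmod (f (of_real t * e))) \<longlongrightarrow> cmod (f (of_real t0 * e))) (at_right t0)"
        using tr' by (simp add: at_within_Icc_at_right)
      have "eventually (\<lambda>t. t \<in> {t0<..<r}) (at_right t0)"
        using tr' by (rule eventually_at_right_real)
      then have "eventually (\<lambda>t. cmod (f (of_real t * e)) \<ge> M) (at_right t0)"
        by eventually_elim (use big in force)
      then show "M \<le> cmod (f (of_real t0 * e))"
        by (intro tendsto_lowerbound[OF *]) auto
    qed
    have ge: "cmod (f (of_real t * e)) \<ge> M" if "t0 \<le> t" "t \<le> r" for t
      using big[of t] M' that by (cases "t = t0") auto
    have "\<phi> r \<le> \<phi> t0"
    proof (rule DERIV_nonpos_imp_nonincreasing[of t0 r \<phi>])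
      show "t0 \<le> r" using tr by simp
      fix t assume t: "t0 \<le> t" "t \<le> r"
      define w where "w = of_real t * e"
      have w: "w \<in> ball 0 1" and t1: "0 \<le> t" "t < 1" using inb[of t] t tr r by (auto simp: w_def)
      have wge: "cmod (f w) \<ge> M" using ge[OF t] by (simp add: w_def)
      have wt: "cmod w \<le> t" unfolding w_def norm_mult using e1 t1 mult_mono[of t t "cmod e" 1] by auto
      have d1: "((\<lambda>t. f (of_real t * e)) has_vector_derivative e * deriv f w) (at t)"
      proof -
        have "((\<lambda>s. of_real s * e) has_vector_derivative e) (at t)"
          by (auto intro!: derivative_eq_intros)
        moreover have "(f has_field_derivative deriv f w) (at (of_real t * e))"
          using holomorphic_derivI[OF holf open_ball w] by (simp add: w_def)
        ultimately show ?thesis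
          using field_vector_diff_chain_at[of "\<lambda>s. of_real s * e" e t f "deriv f w"] by (simp add: o_def)
      qed
      have d2: "((\<lambda>t. (cmod (f (of_real t * e)))\<^sup>2) has_real_derivative 2 * (f w \<bullet> (e * deriv f w))) (at t)"
        unfolding power2_norm_eq_inner has_real_derivative_iff_has_vector_derivative
        using bounded_bilinear.has_vector_derivative[OF bounded_bilinear_inner d1 d1]
        by (simp add: w_def inner_commute)
      have fw: "cmod (f w) > 0" using wge M(1) by linarith
      have d3: "(\<phi> has_real_derivative 2 * (f w \<bullet> (e * deriv f w)) / (cmod (f w))\<^sup>2 - c * (1 / (1 + t) + 1 / (1 - t))) (at t)"
        unfolding \<phi>_def
      proof (intro DERIV_diff DERIV_cmult)
        have "((\<lambda>t. ln ((cmod (f (of_real t * e)))\<^sup>2)) has_real_derivative inverse ((cmod (f w))\<^sup>2) * (2 * (f w \<bullet> (e * deriv f w)))) (at t)"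
          using DERIV_chain2[OF DERIV_ln d2] fw by (simp add: w_def)
        then show "((\<lambda>t. ln ((cmod (f (of_real t * e)))\<^sup>2)) has_real_derivative 2 * (f w \<bullet> (e * deriv f w)) / (cmod (f w))\<^sup>2) (at t)"
          by (simp add: divide_inverse mult_ac)
        have "((\<lambda>t. ln (1 + t) - ln (1 - t)) has_real_derivative 1 / (1 + t) - (- 1) / (1 - t)) (at t)"
          using t1 by (auto intro!: derivative_eq_intros)
        then show "((\<lambda>t. ln (1 + t) - ln (1 - t)) has_real_derivative 1 / (1 + t) + 1 / (1 - t)) (at t)"
          by simp
      qed
      have "f w \<bullet> (e * deriv f w) \<le> cmod (f w) * cmod (e * deriv f w)"
        by (rule norm_cauchy_schwarz)
      also have "\<dots> \<le> cmod (f w) * cmod (deriv f w)"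
        unfolding norm_mult using e1 by (intro mult_left_mono mult_left_le_one_le) auto
      finally have i1: "f w \<bullet> (e * deriv f w) / (cmod (f w))\<^sup>2 \<le> cmod (deriv f w) / cmod (f w)"
        using fw by (simp add: field_simps power2_eq_square)
      have "(1 - t\<^sup>2) * cmod (deriv f w) \<le> (1 - (cmod w)\<^sup>2) * cmod (deriv f w)"
        using wt by (intro mult_right_mono) (auto intro: power_mono)
      also have "\<dots> \<le> c * cmod (f w)" using bd[OF w] wge M by simp
      finally have i2: "(1 - t\<^sup>2) * cmod (deriv f w) \<le> c * cmod (f w)" .
      have tt: "1 - t\<^sup>2 > 0" using t1 by (simp add: power_less_one_iff abs_square_less_1)
      have i3: "cmod (deriv f w) / cmod (f w) \<le> c / (1 - t\<^sup>2)"
        using i2 fw tt by (simp add: field_simps)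
      have i4: "c * (1 / (1 + t) + 1 / (1 - t)) = 2 * (c / (1 - t\<^sup>2))"
        using t1 tt by (simp add: field_simps power2_eq_square)
      have "2 * (f w \<bullet> (e * deriv f w)) / (cmod (f w))\<^sup>2 - c * (1 / (1 + t) + 1 / (1 - t)) \<le> 0"
        using i1 i3 unfolding i4 by simp
      with d3 show "\<exists>y. DERIV \<phi> t :> y \<and> y \<le> 0" by blast
    qed
    moreover have "\<phi> t0 \<le> 2 * ln M"
    proof -
      have "c * (ln (1 + t0) - ln (1 - t0)) \<ge> 0"
        using tr tr' r c by (intro mult_nonneg_nonneg) auto
      then show ?thesis using M by (simp add: \<phi>_def M' ln_realpow)
    qed
    moreover have fz: "cmod (f z) \<ge> M" using ge[of r] tr ze by simp
    moreover have "\<phi> r = 2 * ln (cmod (f z)) - c * ln ((1 + r) / (1 - r))"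
      using r fz M by (simp add: \<phi>_def ze[symmetric] ln_realpow ln_div)
    ultimately have "ln (cmod (f z)) \<le> ln M + c / 2 * ln ((1 + r) / (1 - r))" by simp
    also have "\<dots> = ln (M * ((1 + r) / (1 - r)) powr (c / 2))"
      using M r by (simp add: ln_mult ln_powr)
    finally have "cmod (f z) \<le> M * ((1 + r) / (1 - r)) powr (c / 2)"
      using M fz r by (subst (asm) ln_le_cancel_iff) auto
    then show ?thesis by (simp add: M_def r_def)
  qed
qed

subsection \<open>Normal families of functions omitting moving points\<close>

text \<open>An affine map takes \<open>u, v\<close> to \<open>0, 1\<close>, reducing to Schottky's
  theorem. The bound involves only \<open>M\<close>, \<open>d\<close> and \<open>t\<close>, so it is
  uniform over families whose omitted points move but stay bounded and separated.\<close>

lemma Schottky_two_points: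
  assumes holf: "f holomorphic_on ball 0 1"
    and u: "\<And>z. z \<in> ball 0 1 \<Longrightarrow> f z \<noteq> u" and v: "\<And>z. z \<in> ball 0 1 \<Longrightarrow> f z \<noteq> v"
    and f0: "cmod (f 0) \<le> M" and uM: "cmod u \<le> M" and vM: "cmod v \<le> M"
    and d: "0 < d" "d \<le> cmod (v - u)"
    and t: "0 < t" "t < 1" and z: "cmod z \<le> t"
  shows "cmod (f z) \<le> M + 2 * M * exp (pi * exp (pi * (2 + 4 * M / d + 12 * (2 * t / (1 + t)) / (1 - 2 * t / (1 + t)))))"
proof -
  \<comment> \<open>\<open>Schottky\<close> asks for holomorphy on the closed disc. Dilating by an
    \<open>R\<close> strictly between \<open>t\<close> and 1 provides it and keeps
    \<open>t / R < 1\<close>.\<close>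
  define R where "R = (1 + t) / 2"
  have R: "0 < R" "R < 1" "t < R" using t by (auto simp: R_def)
  define h where "h = (\<lambda>z. (f (of_real R * z) - u) / (v - u))"
  have vu: "v - u \<noteq> 0" using d by auto
  have M0: "0 \<le> M" using f0 norm_ge_zero order_trans by blast
  have inb: "of_real R * z \<in> ball 0 1" if "z \<in> cball 0 1" for z :: complex
  proof -
    have "cmod (of_real R * z) \<le> R * 1"
      unfolding norm_mult using that R by (intro mult_mono) auto
    then show ?thesis using R by simp
  qed
  have "cmod (h (z / R)) \<le> exp (pi * exp (pi * (2 + 2 * (2 * M / d) + 12 * (t / R) / (1 - t / R))))"
  proof (rule Schottky[of h])
    show "h holomorphic_on cball 0 1"
      unfolding h_def using vu inb
      by (intro holomorphic_intros holomorphic_on_compose_gen[OF _ holf, unfolded o_def]) auto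
    have "cmod (f 0 - u) \<le> 2 * M" using norm_triangle_ineq4[of "f 0" u] f0 uM by simp
    then show "cmod (h 0) \<le> 2 * M / d"
      using d M0 by (simp add: h_def norm_divide frac_le)
    show "\<not> (h z = 0 \<or> h z = 1)" if "z \<in> cball 0 1" for z
      using u[OF inb[OF that]] v[OF inb[OF that]] vu by (auto simp: h_def)
    show "cmod (z / of_real R) \<le> t / R" using z R by (simp add: norm_divide divide_right_mono)
  qed (use R t in auto)
  also have "t / R = 2 * t / (1 + t)" by (simp add: R_def)
  also have "2 * (2 * M / d) = 4 * M / d" by simp
  finally have *: "cmod (h (z / R)) \<le> exp (pi * exp (pi * (2 + 4 * M / d + 12 * (2 * t / (1 + t)) / (1 - 2 * t / (1 + t)))))" (is "_ \<le> ?E") .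
  have "f z = u + (v - u) * h (z / R)" using vu R by (simp add: h_def)
  then have "cmod (f z) \<le> cmod u + cmod (v - u) * cmod (h (z / R))"
    by (metis norm_mult norm_triangle_ineq)
  also have "cmod (v - u) \<le> 2 * M" using norm_triangle_ineq4[of v u] uM vM by simp
  also have "cmod u + 2 * M * cmod (h (z / R)) \<le> M + 2 * M * ?E"
    using uM * M0 by (intro add_mono mult_left_mono) auto
  finally show ?thesis by (simp add: mult_right_mono)
qed

text \<open>The omitted points near \<open>p\<close> and \<open>q\<close> give local bounds by
  Schottky, hence a convergent subsequence by Montel. Hurwitz, applied to \<open>F n\<close> minus
  the moving omitted point, passes the omission to a nonconstant limit.\<close>

lemma normal_limit_omits:
  fixes F :: "nat \<Rightarrow> complex \<Rightarrow> complex"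
  assumes hol: "\<And>n. F n holomorphic_on ball 0 1"
    and F0: "\<And>n. cmod (F n 0) \<le> M"
    and T: "\<And>p. p \<in> T \<Longrightarrow> \<exists>e. e \<longlonglongrightarrow> p \<and> (\<forall>\<^sub>F n in sequentially. e n \<notin> F n ` ball 0 1)"
    and pq: "p \<in> T" "q \<in> T" "p \<noteq> q"
  obtains g r where "g holomorphic_on ball 0 1" "strict_mono (r :: nat \<Rightarrow> nat)"
    "(\<lambda>n. F (r n) 0) \<longlonglongrightarrow> g 0" "(\<lambda>n. deriv (F (r n)) 0) \<longlonglongrightarrow> deriv g 0"
    "g constant_on ball 0 1 \<or> g ` ball 0 1 \<inter> T = {}"
proof -
  obtain u where u: "u \<longlonglongrightarrow> p" "\<forall>\<^sub>F n in sequentially. u n \<notin> F n ` ball 0 1"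
    using T[OF pq(1)] by blast
  obtain v where v: "v \<longlonglongrightarrow> q" "\<forall>\<^sub>F n in sequentially. v n \<notin> F n ` ball 0 1"
    using T[OF pq(2)] by blast
  define d where "d = cmod (q - p) / 2"
  define M' where "M' = max M (max (cmod p + 1) (cmod q + 1))"
  have d: "d > 0" "d < cmod (q - p)" using pq by (auto simp: d_def)
  have "(\<lambda>n. cmod (v n - u n)) \<longlonglongrightarrow> cmod (q - p)" by (intro tendsto_intros u v)
  then have e1: "\<forall>\<^sub>F n in sequentially. d < cmod (v n - u n)" using d(2) by (rule order_tendstoD)
  have e2: "\<forall>\<^sub>F n in sequentially. cmod (u n) < cmod p + 1"
    by (rule order_tendstoD[OF tendsto_norm[OF u(1)]]) simp
  have e3: "\<forall>\<^sub>F n in sequentially. cmod (v n) < cmod q + 1"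
    by (rule order_tendstoD[OF tendsto_norm[OF v(1)]]) simp
  have "\<forall>\<^sub>F n in sequentially. d \<le> cmod (v n - u n) \<and> cmod (u n) \<le> M' \<and> cmod (v n) \<le> M'
      \<and> u n \<notin> F n ` ball 0 1 \<and> v n \<notin> F n ` ball 0 1"
    using e1 e2 e3 u(2) v(2) by eventually_elim (auto simp: M'_def)
  then obtain N where N: "\<And>n. n \<ge> N \<Longrightarrow> d \<le> cmod (v n - u n) \<and> cmod (u n) \<le> M' \<and> cmod (v n) \<le> M'
      \<and> u n \<notin> F n ` ball 0 1 \<and> v n \<notin> F n ` ball 0 1"
    unfolding eventually_sequentially by blast
  \<comment> \<open>Montel needs bounds for the whole sequence, so the finitely many terms before
    \<open>N\<close> are dropped.\<close>
  define H where "H = (\<lambda>n. F (n + N))"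
  have bdd: "\<exists>B. \<forall>h \<in> range H. \<forall>z \<in> K. cmod (h z) \<le> B" if K: "compact K" "K \<subseteq> ball 0 1" for K
  proof -
    have "\<exists>t. 0 < t \<and> t < 1 \<and> (\<forall>z\<in>K. cmod z \<le> t)"
    proof (cases "K = {}")
      case True
      then show ?thesis by (intro exI[of _ "1/2"]) auto
    next
      case False
      obtain z where z: "z \<in> K" "\<And>w. w \<in> K \<Longrightarrow> cmod w \<le> cmod z"
        using continuous_attains_sup[OF K(1) False continuous_on_norm_id] by blast
      moreover have "cmod z < 1" using z(1) K(2) by auto
      ultimately show ?thesis
        by (intro exI[of _ "max (1/2) (cmod z)"]) (simp add: le_max_iff_disj)
    qed
    then obtain t where t: "0 < t" "t < 1" "\<forall>z\<in>K. cmod z \<le> t" by blast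
    have "cmod (F (n + N) z) \<le> M' + 2 * M' * exp (pi * exp (pi * (2 + 4 * M' / d + 12 * (2 * t / (1 + t)) / (1 - 2 * t / (1 + t)))))"
      if "z \<in> K" for n z
    proof (rule Schottky_two_points[where u = "u (n + N)" and v = "v (n + N)" and f = "F (n + N)"])
      show "cmod (F (n + N) 0) \<le> M'" using F0[of "n + N"] by (simp add: M'_def)
      show "0 < t" "t < 1" "cmod z \<le> t" "0 < d" using t that d by auto
      show "d \<le> cmod (v (n + N) - u (n + N))" "cmod (u (n + N)) \<le> M'" "cmod (v (n + N)) \<le> M'"
        using N[of "n + N"] by auto
      show "F (n + N) x \<noteq> u (n + N)" "F (n + N) x \<noteq> v (n + N)" if "x \<in> ball 0 1" for x
        using N[of "n + N"] that by (metis imageI le_add2)+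
    qed (rule hol)
    then show ?thesis unfolding H_def by blast
  qed
  obtain g r where g: "g holomorphic_on ball 0 1" "strict_mono (r :: nat \<Rightarrow> nat)"
     and lim: "\<And>x. x \<in> ball 0 1 \<Longrightarrow> ((\<lambda>n. H (r n) x) \<longlongrightarrow> g x) sequentially"
     and ul: "\<And>K. \<lbrakk>compact K; K \<subseteq> ball 0 1\<rbrakk> \<Longrightarrow> uniform_limit K (H \<circ> r) g sequentially"
  proof (rule Montel[of "ball 0 1" "range H" H])
    show "h holomorphic_on ball 0 1" if "h \<in> range H" for h
      using that hol by (auto simp: H_def)
  qed (use bdd in auto)
  define s where "s = (\<lambda>n. r n + N)"
  have s: "strict_mono s" using g(2) by (auto simp: s_def strict_mono_def)
  have Hr: "H \<circ> r = (\<lambda>n. F (s n))" by (auto simp: H_def s_def)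
  \<comment> \<open>Locally uniform convergence carries over to derivatives.\<close>
  have "\<exists>g'. \<forall>x \<in> ball 0 1. (g has_field_derivative g' x) (at x) \<and> ((\<lambda>n. deriv (F (s n)) x) \<longlongrightarrow> g' x) sequentially"
  proof (rule has_complex_derivative_uniform_sequence)
    show "(F (s n) has_field_derivative deriv (F (s n)) x) (at x)" if "x \<in> ball 0 1" for n x
      using holomorphic_derivI[OF hol open_ball that] .
    show "\<exists>d. 0 < d \<and> cball x d \<subseteq> ball 0 1 \<and> uniform_limit (cball x d) (\<lambda>n. F (s n)) g sequentially"
      if x: "x \<in> ball 0 1" for x
    proof -
      obtain d where "0 < d" "cball x d \<subseteq> ball 0 1"
        using x open_contains_cball_eq[OF open_ball] by blast
      then show ?thesis using ul[of "cball x d"] Hr by auto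
    qed
  qed auto
  then have dlim: "(\<lambda>n. deriv (F (s n)) 0) \<longlonglongrightarrow> deriv g 0"
    by (metis DERIV_imp_deriv centre_in_ball zero_less_one)
  have "g ` ball 0 1 \<inter> T = {}" if nc: "\<not> g constant_on ball 0 1"
  proof -
    have "g z \<noteq> w" if w: "w \<in> T" and z: "z \<in> ball 0 1" for w z
    proof -
      obtain e where e: "e \<longlonglongrightarrow> w" "\<forall>\<^sub>F n in sequentially. e n \<notin> F n ` ball 0 1"
        using T[OF w] by blast
      then obtain K where K: "\<And>n. n \<ge> K \<Longrightarrow> e n \<notin> F n ` ball 0 1"
        unfolding eventually_sequentially by blast
      \<comment> \<open>The threshold \<open>K\<close> depends on \<open>w\<close>, whereas
        \<open>Hurwitz_no_zeros\<close> wants every term free of zeros; hence a further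
        shift.\<close>
      define \<sigma> where "\<sigma> = (\<lambda>n. s (n + K))"
      have \<sigma>: "strict_mono \<sigma>" using s by (auto simp: \<sigma>_def strict_mono_def)
      have "g z - w \<noteq> 0"
      proof (rule Hurwitz_no_zeros[of "ball 0 1" "\<lambda>n z. F (\<sigma> n) z - e (\<sigma> n)" "\<lambda>z. g z - w"])
        show "uniform_limit S (\<lambda>n z. F (\<sigma> n) z - e (\<sigma> n)) (\<lambda>z. g z - w) sequentially"
          if S: "compact S" "S \<subseteq> ball 0 1" for S
        proof (rule uniform_limit_minus)
          have "strict_mono (\<lambda>n::nat. n + K)" by (auto simp: strict_mono_def)
          then have "filterlim (\<lambda>n. n + K) sequentially sequentially" by (rule filterlim_subseq)
          then show "uniform_limit S (\<lambda>n. F (\<sigma> n)) g sequentially"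
            unfolding \<sigma>_def by (rule filterlim_compose[OF ul[OF S, unfolded Hr]])
          have "(e \<circ> \<sigma>) \<longlonglongrightarrow> w" by (rule LIMSEQ_subseq_LIMSEQ[OF e(1) \<sigma>])
          then show "uniform_limit S (\<lambda>n z. e (\<sigma> n)) (\<lambda>z. w) sequentially"
            by (auto simp: uniform_limit_iff tendsto_iff o_def)
        qed
        show "\<not> (\<lambda>z. g z - w) constant_on ball 0 1"
        proof
          assume "(\<lambda>z. g z - w) constant_on ball 0 1"
          then obtain k where "\<And>z. z \<in> ball 0 1 \<Longrightarrow> g z - w = k" by (auto simp: constant_on_def)
          then have "\<And>z. z \<in> ball 0 1 \<Longrightarrow> g z = k + w" by (metis diff_add_cancel)
          then show False using nc unfolding constant_on_def by blast
        qed
        show "F (\<sigma> n) x - e (\<sigma> n) \<noteq> 0" if "x \<in> ball 0 1" for n x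
        proof -
          have "K \<le> \<sigma> n" using seq_suble[OF s, of "n + K"] by (simp add: \<sigma>_def)
          then show ?thesis using K[of "\<sigma> n"] that by (metis eq_iff_diff_eq_0 imageI)
        qed
        show "(\<lambda>z. F (\<sigma> n) z - e (\<sigma> n)) holomorphic_on ball 0 1" for n
          by (intro holomorphic_intros hol)
        show "(\<lambda>z. g z - w) holomorphic_on ball 0 1"
          by (intro holomorphic_intros g)
      qed (use z in auto)
      then show ?thesis by simp
    qed
    then show ?thesis by blast
  qed
  moreover have "(\<lambda>n. F (s n) 0) \<longlonglongrightarrow> g 0" using lim[of 0] by (simp add: H_def s_def)
  ultimately show ?thesis using that g(1) s dlim by blast
qed

section \<open>The Bloch-type derivative bound for large values\<close>

text \<open>\<open>T\<close> collects the limits of omitted points under rescaling. Dividing a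
  sequence of counterexamples by \<open>cmod (f n 0)\<close> keeps the derivative at 0 of modulus at
  least \<open>c\<close> and normalises the value to modulus 1, so a limit contradicts
  \<open>deriv_le_of_sector\<close>.\<close>

lemma deriv_bound_far:
  fixes G T :: "complex set"
  assumes a: "0 < a" and c: "c > 4 * a / pi"
    and T: "\<And>p. p \<in> T \<Longrightarrow> \<exists>e :: real \<Rightarrow> complex. (\<forall>\<^sub>F t in at_top. e t \<notin> G) \<and> ((\<lambda>t. e t / of_real t) \<longlongrightarrow> p) at_top"
    and pq: "p \<in> T" "q \<in> T" "p \<noteq> q"
    and sect: "\<And>U w. \<lbrakk>open U; U \<inter> T = {}; w \<in> U\<rbrakk> \<Longrightarrow> w \<notin> \<real>\<^sub>\<le>\<^sub>0 \<and> \<bar>Im (Ln w)\<bar> < a"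
  obtains R where "R > 0"
    "\<And>f. \<lbrakk>f \<in> Hol_disc G; cmod (f 0) \<ge> R\<rbrakk> \<Longrightarrow> cmod (deriv f 0) \<le> c * cmod (f 0)"
proof -
  have "\<exists>R>0. \<forall>f. f \<in> Hol_disc G \<longrightarrow> cmod (f 0) \<ge> R \<longrightarrow> cmod (deriv f 0) \<le> c * cmod (f 0)"
  proof (rule ccontr)
    assume contra: "\<not> ?thesis"
    have "\<exists>f. f \<in> Hol_disc G \<and> cmod (f 0) \<ge> real n + 1 \<and> cmod (deriv f 0) > c * cmod (f 0)" for n
      using contra[simplified, rule_format, of "real n + 1"] by (auto simp: not_le)
    then obtain f where f: "\<And>n. f n \<in> Hol_disc G" "\<And>n. cmod (f n 0) \<ge> real n + 1"
      "\<And>n. cmod (deriv (f n) 0) > c * cmod (f n 0)" by metis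
    define t where "t = (\<lambda>n. cmod (f n 0))"
    have tpos: "t n > 0" for n using f(2)[of n] unfolding t_def by linarith
    have t_inf: "filterlim t at_top sequentially"
    proof (rule filterlim_at_top_mono)
      show "filterlim (\<lambda>n. real n) at_top sequentially" by (rule filterlim_real_sequentially)
      show "\<forall>\<^sub>F n in sequentially. real n \<le> t n"
      proof (intro always_eventually allI)
        show "real n \<le> t n" for n using f(2)[of n] unfolding t_def by linarith
      qed
    qed
    define F where "F = (\<lambda>n z. f n z / of_real (t n))"
    have holf: "f n holomorphic_on ball 0 1" for n using f(1)[of n] by (simp add: Hol_disc_def)
    have hol: "F n holomorphic_on ball 0 1" for n
      unfolding F_def using tpos[of n] by (intro holomorphic_intros holf) auto
    have F0: "cmod (F n 0) = 1" for n using tpos[of n] by (simp add: F_def norm_divide t_def)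
    have dF: "deriv (F n) 0 = deriv (f n) 0 / of_real (t n)" for n
    proof (rule DERIV_imp_deriv)
      have "(f n has_field_derivative deriv (f n) 0) (at 0)"
        using holomorphic_derivI[OF holf open_ball, of 0] by simp
      then show "(F n has_field_derivative deriv (f n) 0 / of_real (t n)) (at 0)"
        unfolding F_def by (rule DERIV_cdivide)
    qed
    have dF': "cmod (deriv (F n) 0) \<ge> c" for n
      using f(3)[of n] tpos[of n] unfolding dF by (simp add: norm_divide t_def field_simps)
    have approx: "\<exists>e. e \<longlonglongrightarrow> p \<and> (\<forall>\<^sub>F n in sequentially. e n \<notin> F n ` ball 0 1)" if pT: "p \<in> T" for p
    proof -
      obtain e where e: "\<forall>\<^sub>F t in at_top. e t \<notin> G" "((\<lambda>t. e t / of_real t) \<longlongrightarrow> p) at_top"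
        using T[OF pT] by blast
      have "(\<lambda>n. e (t n) / of_real (t n)) \<longlonglongrightarrow> p"
        by (rule filterlim_compose[OF e(2) t_inf])
      moreover have "\<forall>\<^sub>F n in sequentially. e (t n) \<notin> G"
        by (rule eventually_compose_filterlim[OF e(1) t_inf])
      then have "\<forall>\<^sub>F n in sequentially. e (t n) / of_real (t n) \<notin> F n ` ball 0 1"
      proof eventually_elim
        case (elim n)
        show ?case
        proof
          assume "e (t n) / of_real (t n) \<in> F n ` ball 0 1"
          then obtain z where "z \<in> ball 0 1" "e (t n) = f n z"
            using tpos[of n] by (auto simp: F_def)
          then show False using elim f(1)[of n] unfolding Hol_disc_def by blast
        qed
      qed
      ultimately show ?thesis by blast
    qed
    obtain g r where g: "g holomorphic_on ball 0 1" "strict_mono (r :: nat \<Rightarrow> nat)"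
      and lim: "(\<lambda>n. F (r n) 0) \<longlonglongrightarrow> g 0" "(\<lambda>n. deriv (F (r n)) 0) \<longlonglongrightarrow> deriv g 0"
      and om: "g constant_on ball 0 1 \<or> g ` ball 0 1 \<inter> T = {}"
      using normal_limit_omits[OF hol _ approx pq, of 1] F0 by (metis order_refl)
    have cpos: "c > 0" using a c by (smt (verit) divide_pos_pos pi_gt_zero)
    have g0: "cmod (g 0) = 1"
      using tendsto_norm[OF lim(1)] F0 by (simp add: LIMSEQ_const_iff)
    have dg: "cmod (deriv g 0) \<ge> c"
      using tendsto_norm[OF lim(2)] by (rule tendsto_lowerbound) (use dF' in auto)
    \<comment> \<open>The derivative of the limit at 0 has modulus at least \<open>c > 0\<close>,
      which excludes the exceptional case of Hurwitz.\<close>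
    have nc: "\<not> g constant_on ball 0 1"
    proof
      assume "g constant_on ball 0 1"
      then obtain k where k: "\<And>z. z \<in> ball 0 1 \<Longrightarrow> g z = k" by (auto simp: constant_on_def)
      have "deriv g 0 = deriv (\<lambda>_. k) 0"
        by (rule deriv_cong_ev) (use k in \<open>auto intro!: eventually_nhds_in_open elim!: eventually_mono simp: eventually_nhds intro: exI[of _ "ball 0 1"]\<close>)
      then show False using dg cpos by simp
    qed
    \<comment> \<open>Avoiding \<open>T\<close> alone would still allow values on the boundary of
      the sector; openness of the image rules them out through \<open>sect\<close>.\<close>
    have "open (g ` ball 0 1)"
      by (rule open_mapping_thm[OF g(1)]) (use nc in auto)
    then have "g z \<notin> \<real>\<^sub>\<le>\<^sub>0 \<and> \<bar>Im (Ln (g z))\<bar> < a" if "z \<in> ball 0 1" for z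
      using sect[of "g ` ball 0 1" "g z"] om nc that by blast
    then have "cmod (deriv g 0) \<le> 4 * a / pi * cmod (g 0)"
      by (intro deriv_le_of_sector[OF a g(1)]) auto
    then show False using dg c g0 by simp
  qed
  then show ?thesis using that by blast
qed

text \<open>The estimate is invariant under disc automorphisms: the one taking 0 to \<open>z\<close>
  used here has derivative \<open>1 - (cmod z)\<^sup>2\<close> at 0.\<close>

lemma deriv_bound_disc:
  assumes f: "f \<in> Hol_disc G" and z: "z \<in> ball 0 1" and big: "cmod (f z) \<ge> R"
    and bd: "\<And>g. \<lbrakk>g \<in> Hol_disc G; cmod (g 0) \<ge> R\<rbrakk> \<Longrightarrow> cmod (deriv g 0) \<le> c * cmod (g 0)"
  shows "(1 - (cmod z)\<^sup>2) * cmod (deriv f z) \<le> c * cmod (f z)"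
proof -
  define \<phi> where "\<phi> = Moebius_function 0 (-z)"
  have holf: "f holomorphic_on ball 0 1" using f by (simp add: Hol_disc_def)
  have hol\<phi>: "\<phi> holomorphic_on ball 0 1"
    unfolding \<phi>_def using z by (intro Moebius_function_holomorphic) auto
  have im: "\<phi> w \<in> ball 0 1" if "w \<in> ball 0 1" for w
    unfolding \<phi>_def using z that Moebius_function_norm_lt_1[of "-z" w 0] by auto
  have \<phi>0: "\<phi> 0 = z" by (simp add: \<phi>_def Moebius_function_of_zero)
  have "(f \<circ> \<phi>) holomorphic_on ball 0 1"
    by (rule holomorphic_on_compose_gen[OF hol\<phi> holf]) (use im in auto)
  then have mem: "f \<circ> \<phi> \<in> Hol_disc G"
    using f im by (auto simp: Hol_disc_def)
  have "1 - cnj z * z = of_real (1 - (cmod z)\<^sup>2)"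
    by (metis complex_norm_square mult.commute of_real_1 of_real_diff)
  then have "(\<phi> has_field_derivative of_real (1 - (cmod z)\<^sup>2)) (at 0)"
    unfolding \<phi>_def Moebius_function_simple
    by - (rule derivative_eq_intros refl | simp add: mult.commute)+
  moreover have "(f has_field_derivative deriv f z) (at (\<phi> 0))"
    unfolding \<phi>0 using holomorphic_derivI[OF holf open_ball z] by simp
  ultimately have "(f \<circ> \<phi> has_field_derivative deriv f z * of_real (1 - (cmod z)\<^sup>2)) (at 0)"
    by (intro DERIV_chain)
  then have "deriv (f \<circ> \<phi>) 0 = deriv f z * of_real (1 - (cmod z)\<^sup>2)" by (rule DERIV_imp_deriv)
  moreover have "(cmod z)\<^sup>2 < 1" using z by (simp add: abs_square_less_1)
  ultimately show ?thesis using bd[OF mem] big \<phi>0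
    by (simp add: norm_mult mult.commute del: of_real_diff)
qed

subsection \<open>Membership in weighted Bergman spaces\<close>

lemma bergman_number_geI:
  assumes "\<And>y. \<lbrakk>0 < y; y < v\<rbrakk> \<Longrightarrow> ereal y \<le> bergman_number f"
  shows "ereal v \<le> bergman_number f"
proof (rule dense_le)
  fix x assume x: "x < ereal v"
  show "x \<le> bergman_number f"
  proof (cases "x \<le> 0")
    case True
    also have "0 \<le> bergman_number f" unfolding bergman_number_def by (rule Sup_upper) simp
    finally show ?thesis .
  next
    case False
    then show ?thesis using x assms by (cases x) auto
  qed
qed

text \<open>With \<open>p = v * \<alpha>\<close> the weight exactly cancels the growth of the p-th
  power of the modulus, and the ratio \<open>v * \<alpha> / (\<alpha> + 2)\<close> takes every value
  in \<open>(0, v)\<close> as \<alpha> runs over the positive reals.\<close>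

lemma bergman_number_ge_of_growth:
  assumes holf: "f holomorphic_on ball 0 1" and v: "0 < v"
    and gr: "\<And>z. z \<in> ball 0 1 \<Longrightarrow> cmod (f z) \<le> K * (1 - cmod z) powr (- (1 / v))"
  shows "ereal v \<le> bergman_number f"
proof -
  have K: "0 \<le> K" using order_trans[OF norm_ge_zero gr[of 0]] by simp
  have *: "ereal y \<le> bergman_number f" if y: "0 < y" "y < v" for y
  proof -
    \<comment> \<open>This choice gives \<open>p / (\<alpha> + 2) = y\<close> and makes the integrand bounded by \<open>K powr p\<close>.\<close>
    define \<alpha> where "\<alpha> = 2 * y / (v - y)"
    define p where "p = v * \<alpha>"
    have \<alpha>: "\<alpha> > 0" and p: "p > 0" using y v by (auto simp: \<alpha>_def p_def)
    have "\<alpha> + 2 = 2 * v / (v - y)" using y by (simp add: \<alpha>_def field_simps)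
    then have py: "p / (\<alpha> + 2) = y" using y v by (simp add: p_def \<alpha>_def field_simps)
    have bd: "cmod (f z) powr p * (1 - cmod z) powr \<alpha> \<le> K powr p" if z: "z \<in> ball 0 1" for z
    proof -
      have z1: "1 - cmod z > 0" using z by simp
      have "cmod (f z) powr p \<le> (K * (1 - cmod z) powr (- (1 / v))) powr p"
        using gr[OF z] p by (intro powr_mono2) auto
      also have "\<dots> = K powr p * (1 - cmod z) powr (- \<alpha>)"
        using K v by (simp add: powr_mult powr_powr p_def)
      finally have "cmod (f z) powr p * (1 - cmod z) powr \<alpha> \<le>
          K powr p * (1 - cmod z) powr (- \<alpha>) * (1 - cmod z) powr \<alpha>"
        by (intro mult_right_mono) auto
      also have "\<dots> = K powr p"
        using z1 by (simp add: mult.assoc flip: powr_add)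
      finally show ?thesis .
    qed
    have "(\<integral>\<^sup>+ z \<in> ball 0 1. ennreal (cmod (f z) powr p * (1 - cmod z) powr \<alpha>) \<partial>lborel)
       \<le> (\<integral>\<^sup>+ z. ennreal (K powr p) * indicator (ball (0::complex) 1) z \<partial>lborel)"
      using bd by (intro nn_integral_mono) (auto simp: indicator_def intro: ennreal_leI)
    also have "\<dots> = ennreal (K powr p) * emeasure lborel (ball (0::complex) 1)"
      by (simp add: nn_integral_cmult_indicator)
    also have "\<dots> < \<infinity>"
      by (simp add: ennreal_mult_less_top emeasure_ball)
    finally have "f \<in> bergman_space p \<alpha>" using holf by (simp add: bergman_space_def)
    then have "ereal y \<in> {ereal (p / (\<alpha> + 2)) | p \<alpha>. p > 0 \<and> \<alpha> > -1 \<and> f \<in> bergman_space p \<alpha>} \<union> {0}"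
      using py p \<alpha> by (intro UnI1 CollectI exI[of _ p] exI[of _ \<alpha>]) auto
    then show ?thesis unfolding bergman_number_def by (rule Sup_upper)
  qed
  then show ?thesis by (rule bergman_number_geI)
qed

section \<open>The extremal function and its Bergman number\<close>

definition cusp_power :: "real \<Rightarrow> complex \<Rightarrow> complex" where
  "cusp_power k z = exp (- of_real k * Ln (1 - z))"

lemma one_minus_not_nonpos: "1 - z \<notin> \<real>\<^sub>\<le>\<^sub>0" if "z \<in> ball 0 1" for z :: complex
  using that complex_Re_le_cmod[of z] by (auto simp: complex_nonpos_Reals_iff)

lemma holomorphic_cusp_power: "cusp_power k holomorphic_on ball 0 1"
  unfolding cusp_power_def[abs_def] by (intro holomorphic_intros one_minus_not_nonpos)

lemma norm_cusp_power: "z \<noteq> 1 \<Longrightarrow> cmod (cusp_power k z) = cmod (1 - z) powr (- k)"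
  by (simp add: cusp_power_def powr_def)

text \<open>Since \<open>1 - z\<close> lies in the right half-plane, its argument is below
  \<open>pi / 2\<close> in modulus. The condition \<open>k \<le> 2\<close> keeps the multiplied
  argument below \<open>pi\<close>, so that \<open>Ln\<close> inverts \<open>exp\<close>.\<close>

lemma Ln_cusp_power:
  assumes z: "z \<in> ball 0 1" and k: "0 \<le> k" "k \<le> 2"
  shows "cusp_power k z \<noteq> 0" "Ln (cusp_power k z) = - of_real k * Ln (1 - z)"
    "\<bar>Im (Ln (1 - z))\<bar> < pi / 2"
proof -
  show "cusp_power k z \<noteq> 0" by (simp add: cusp_power_def)
  have "Re (1 - z) > 0" using z complex_Re_le_cmod[of z] by auto
  then show 1: "\<bar>Im (Ln (1 - z))\<bar> < pi / 2" using Re_Ln_pos_lt_imp by blast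
  have "\<bar>k * Im (Ln (1 - z))\<bar> \<le> 2 * \<bar>Im (Ln (1 - z))\<bar>"
    using k by (simp add: abs_mult mult_right_mono)
  also have "\<dots> < pi" using 1 by simp
  finally show "Ln (cusp_power k z) = - of_real k * Ln (1 - z)"
    unfolding cusp_power_def by (intro Ln_exp) auto
qed

text \<open>A disc of radius \<delta> near 1 has area of order \<open>\<delta> powr 2\<close> and
  carries an integrand of order at least \<open>\<delta> powr (\<alpha> - p * k)\<close>. The
  product is unbounded as \<delta> tends to 0.\<close>

lemma cusp_power_not_bergman:
  assumes \<alpha>: "\<alpha> > -1" and p: "p > 0" and s: "p * k > \<alpha> + 2"
  shows "cusp_power k \<notin> bergman_space p \<alpha>"
proof
  assume mem: "cusp_power k \<in> bergman_space p \<alpha>"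
  define I where "I = (\<integral>\<^sup>+ z \<in> ball 0 1. ennreal (cmod (cusp_power k z) powr p * (1 - cmod z) powr \<alpha>) \<partial>lborel)"
  define s where "s = p * k"
  define \<eta> where "\<eta> = s - \<alpha> - 2"
  have \<eta>: "\<eta> > 0" using s by (simp add: \<eta>_def s_def)
  have s0: "s > 0" using s \<alpha> by (simp add: s_def)
  \<comment> \<open>On the discs below \<open>1 - cmod z\<close> lies between \<delta> and
    \<open>3 * \<delta>\<close>; the power \<alpha> is smallest at the lower end for
    \<open>\<alpha> \<ge> 0\<close> and at the upper end otherwise, and \<open>m\<close> covers both
    signs.\<close>
  define m where "m = min 1 (3 powr \<alpha>)"
  have m: "m > 0" by (simp add: m_def)
  define C where "C = 3 powr (- s) * m * pi"
  have C: "C > 0" using m by (simp add: C_def)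
  have lower: "ennreal (C * \<delta> powr (- \<eta>)) \<le> I" if \<delta>: "0 < \<delta>" "\<delta> \<le> 1 / 3" for \<delta>
  proof -
    \<comment> \<open>On this disc both \<open>\<bar>1 - z\<bar>\<close> and \<open>1 - \<bar>z\<bar>\<close> are comparable to \<open>\<delta>\<close>.\<close>
    define D where "D = ball (1 - 2 * complex_of_real \<delta>) \<delta>"
    define L where "L = (3 * \<delta>) powr (- s) * (\<delta> powr \<alpha> * m)"
    have D: "z \<in> ball 0 1 \<and> L \<le> cmod (cusp_power k z) powr p * (1 - cmod z) powr \<alpha>" if "z \<in> D" for z
    proof -
      have d: "cmod (1 - 2 * complex_of_real \<delta> - z) < \<delta>" using that by (simp add: D_def dist_norm)
      have n: "cmod (1 - 2 * complex_of_real \<delta>) = 1 - 2 * \<delta>"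
      proof -
        have "1 - 2 * complex_of_real \<delta> = of_real (1 - 2 * \<delta>)" by simp
        then have "cmod (1 - 2 * complex_of_real \<delta>) = \<bar>1 - 2 * \<delta>\<bar>" by (simp only: norm_of_real)
        then show ?thesis using \<delta> by simp
      qed
      have up: "cmod z < 1 - \<delta>"
        using norm_triangle_ineq4[of "1 - 2 * complex_of_real \<delta>" "1 - 2 * complex_of_real \<delta> - z"] d n by simp
      have lo: "cmod z > 1 - 3 * \<delta>"
        using norm_triangle_ineq2[of "1 - 2 * complex_of_real \<delta>" z] d n by simp
      have "cmod (1 - z) \<le> cmod (1 - 2 * complex_of_real \<delta> - z) + cmod (2 * complex_of_real \<delta>)"
        using norm_triangle_ineq[of "1 - 2 * complex_of_real \<delta> - z" "2 * complex_of_real \<delta>"] by simp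
      then have x: "cmod (1 - z) \<le> 3 * \<delta>" using d \<delta> by (simp add: norm_mult)
      have z1: "z \<noteq> 1" using up \<delta> by auto
      have "cmod (cusp_power k z) powr p = cmod (1 - z) powr (- s)"
        using z1 by (simp add: norm_cusp_power powr_powr s_def mult.commute)
      moreover have "(3 * \<delta>) powr (- s) \<le> cmod (1 - z) powr (- s)"
        using x z1 s0 by (intro powr_mono2') auto
      moreover have "\<delta> powr \<alpha> * m \<le> (1 - cmod z) powr \<alpha>"
      proof (cases "\<alpha> \<ge> 0")
        case True
        have "\<delta> powr \<alpha> * m \<le> \<delta> powr \<alpha> * 1" by (intro mult_left_mono) (auto simp: m_def)
        also have "\<dots> \<le> (1 - cmod z) powr \<alpha>" using True up \<delta> by (auto intro: powr_mono2)
        finally show ?thesis .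
      next
        case False
        have "\<delta> powr \<alpha> * m \<le> \<delta> powr \<alpha> * 3 powr \<alpha>" by (intro mult_left_mono) (auto simp: m_def)
        also have "\<dots> = (3 * \<delta>) powr \<alpha>" using \<delta> by (simp add: powr_mult)
        also have "\<dots> \<le> (1 - cmod z) powr \<alpha>" using False lo up \<delta> by (intro powr_mono2') auto
        finally show ?thesis .
      qed
      ultimately show ?thesis using up \<delta> m by (auto simp: L_def intro!: mult_mono)
    qed
    have "\<delta> powr (- \<eta>) = \<delta> powr (- s) * \<delta> powr \<alpha> * \<delta> powr 2"
      by (simp add: \<eta>_def algebra_simps flip: powr_add)
    then have "C * \<delta> powr (- \<eta>) = L * (pi * \<delta>\<^sup>2)"
      using \<delta> by (simp add: C_def L_def powr_mult powr_numeral)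
    then have "ennreal (C * \<delta> powr (- \<eta>)) = ennreal L * emeasure lborel D"
      using \<delta> m by (simp add: D_def emeasure_ball unit_ball_vol_2 ennreal_mult L_def)
    also have "\<dots> = (\<integral>\<^sup>+ z. ennreal L * indicator D z \<partial>lborel)"
      by (simp add: nn_integral_cmult_indicator D_def)
    also have "\<dots> \<le> I"
      unfolding I_def using D by (intro nn_integral_mono) (auto simp: indicator_def intro: ennreal_leI)
    finally show ?thesis .
  qed
  have "I < \<infinity>" using mem by (simp add: bergman_space_def I_def)
  then obtain B where B: "B \<ge> 0" "I = ennreal B" by (cases I) auto
  \<comment> \<open>\<open>X\<close> is the reciprocal of the chosen \<delta>: the entry 3 ensures
    \<open>\<delta> \<le> 1 / 3\<close>, the other pushes the lower bound past
    \<open>B\<close>.\<close>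
  define X where "X = max 3 (((B + 1) / C) powr (1 / \<eta>))"
  have X: "X \<ge> 3" by (simp add: X_def)
  have "(B + 1) / C = (((B + 1) / C) powr (1 / \<eta>)) powr \<eta>"
    using B C \<eta> by (simp add: powr_powr)
  also have "\<dots> \<le> X powr \<eta>"
    using \<eta> by (intro powr_mono2) (auto simp: X_def)
  finally have "B + 1 \<le> C * X powr \<eta>" using C by (simp add: field_simps)
  also have "X powr \<eta> = (1 / X) powr (- \<eta>)"
    using X by (simp add: powr_divide powr_minus field_simps)
  finally have "B + 1 \<le> C * (1 / X) powr (- \<eta>)" .
  moreover have "C * (1 / X) powr (- \<eta>) \<le> B"
    using lower[of "1 / X"] X B by (simp add: ennreal_le_iff field_simps)
  ultimately show False by simp
qed

lemma bergman_number_cusp_power: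
  assumes k: "k > 0"
  shows "bergman_number (cusp_power k) \<le> ereal (1 / k)"
  unfolding bergman_number_def
proof (rule Sup_least)
  fix x assume "x \<in> {ereal (p / (\<alpha> + 2)) | p \<alpha>. p > 0 \<and> \<alpha> > -1 \<and> cusp_power k \<in> bergman_space p \<alpha>} \<union> {0}"
  then consider "x = 0" | p \<alpha> where "x = ereal (p / (\<alpha> + 2))" "p > 0" "\<alpha> > -1" "cusp_power k \<in> bergman_space p \<alpha>"
    by blast
  then show "x \<le> ereal (1 / k)"
  proof cases
    case 1 then show ?thesis using k by simp
  next
    case 2
    then have "p * k \<le> \<alpha> + 2" using cusp_power_not_bergman[of \<alpha> p k] by force
    then show ?thesis using 2 k by (simp add: field_simps)
  qed
qed

subsection \<open>Sectors and the omitted lattice\<close>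

text \<open>Rounding \<open>t * p\<close> to the lattice costs less than 1 in each coordinate, which
  vanishes after division by \<open>t\<close>; so the rescaled lattices become dense.\<close>

lemma floor_rounding_tendsto:
  "((\<lambda>t. Complex (of_int \<lfloor>t * Re p\<rfloor>) (of_int \<lfloor>t * Im p\<rfloor>) / of_real t) \<longlongrightarrow> p) at_top"
proof -
  have fl: "((\<lambda>t. of_int \<lfloor>t * x\<rfloor> / t) \<longlongrightarrow> x) at_top" for x :: real
  proof (rule tendsto_sandwich)
    show "\<forall>\<^sub>F t in at_top. x - 1 / t \<le> of_int \<lfloor>t * x\<rfloor> / t"
      using eventually_gt_at_top[of 0]
    proof eventually_elim
      case (elim t)
      have "t * x - 1 \<le> of_int \<lfloor>t * x\<rfloor>" by linarith
      then have "(t * x - 1) / t \<le> of_int \<lfloor>t * x\<rfloor> / t"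
        using elim by (intro divide_right_mono) auto
      then show ?case using elim by (simp add: diff_divide_distrib)
    qed
    show "\<forall>\<^sub>F t in at_top. of_int \<lfloor>t * x\<rfloor> / t \<le> x"
      using eventually_gt_at_top[of 0]
    proof eventually_elim
      case (elim t)
      then show ?case by (simp add: field_simps)
    qed
    have "((\<lambda>t. x - 1 / t) \<longlongrightarrow> x - 0) at_top"
      by (intro tendsto_intros tendsto_divide_0[OF tendsto_const] filterlim_at_top_imp_at_infinity filterlim_ident)
    then show "((\<lambda>t. x - 1 / t) \<longlongrightarrow> x) at_top" by simp
  qed auto
  have "((\<lambda>t. Complex (of_int \<lfloor>t * Re p\<rfloor> / t) (of_int \<lfloor>t * Im p\<rfloor> / t)) \<longlongrightarrow> Complex (Re p) (Im p)) at_top"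
    by (intro tendsto_Complex fl)
  then show ?thesis by (simp add: Complex_divide_complex_of_real)
qed

lemma sector_iff_sin:
  assumes "0 < a" "a < pi"
  shows "z \<in> sector a \<longleftrightarrow> \<bar>Im z\<bar> * cos a < Re z * sin a"
  using sin_gt_zero[OF assms] by (simp add: sector_def cot_def field_simps)

text \<open>In polar form the sine version of the sector inequality reads
  \<open>sin (a - \<bar>\<theta>\<bar>) > 0\<close>, which on the range of the principal argument
  means \<open>\<bar>\<theta>\<bar> < a\<close>.\<close>

lemma sector_iff_Ln:
  assumes a: "0 < a" "a < pi"
  shows "z \<in> sector a \<longleftrightarrow> z \<notin> \<real>\<^sub>\<le>\<^sub>0 \<and> \<bar>Im (Ln z)\<bar> < a"
proof (cases "z = 0")
  case True
  then show ?thesis using sector_iff_sin[OF a] by simp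
next
  case False
  define \<theta> where "\<theta> = Im (Ln z)"
  have th: "\<bar>\<theta>\<bar> \<le> pi" using mpi_less_Im_Ln[OF False] Im_Ln_le_pi[OF False] by (auto simp: \<theta>_def)
  have "z = exp (Ln z)" using False by simp
  then have re: "Re z = cmod z * cos \<theta>" and im: "Im z = cmod z * sin \<theta>"
    using False by (metis Re_exp Im_exp \<theta>_def norm_exp_eq_Re)+
  have "\<bar>sin \<theta>\<bar> = sin \<bar>\<theta>\<bar>"
    using th sin_ge_zero[of "\<bar>\<theta>\<bar>"] by (cases "\<theta> \<ge> 0") auto
  then have im': "\<bar>Im z\<bar> = cmod z * sin \<bar>\<theta>\<bar>" by (simp add: im abs_mult)
  have "z \<in> sector a \<longleftrightarrow> cmod z * sin (a - \<bar>\<theta>\<bar>) > 0"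
    unfolding sector_iff_sin[OF a] im' re sin_diff by (simp add: algebra_simps)
  also have "\<dots> \<longleftrightarrow> sin (a - \<bar>\<theta>\<bar>) > 0" using False by (simp add: zero_less_mult_iff)
  also have "\<dots> \<longleftrightarrow> \<bar>\<theta>\<bar> < a"
  proof
    assume "sin (a - \<bar>\<theta>\<bar>) > 0"
    moreover have "sin (\<bar>\<theta>\<bar> - a) \<ge> 0" if "a \<le> \<bar>\<theta>\<bar>" using that th a by (intro sin_ge_zero) auto
    moreover have "sin (\<bar>\<theta>\<bar> - a) = - sin (a - \<bar>\<theta>\<bar>)" by (metis minus_diff_eq sin_minus)
    ultimately show "\<bar>\<theta>\<bar> < a" by force
  qed (use a in \<open>auto intro!: sin_gt_zero\<close>)
  also have "\<dots> \<longleftrightarrow> z \<notin> \<real>\<^sub>\<le>\<^sub>0 \<and> \<bar>\<theta>\<bar> < a"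
  proof -
    \<comment> \<open>On the slit \<open>Ln\<close> takes argument \<open>pi\<close>, which exceeds
      \<open>a\<close>, so the slit condition is automatic.\<close>
    have "\<theta> = pi" if "z \<in> \<real>\<^sub>\<le>\<^sub>0"
      using that False Im_Ln_eq_pi[OF False] by (auto simp: \<theta>_def complex_nonpos_Reals_iff complex_eq_iff)
    then show ?thesis using a by auto
  qed
  finally show ?thesis by (simp add: \<theta>_def)
qed

lemma closure_sector_subset:
  assumes "0 < a" "a < pi"
  shows "closure (sector a) \<subseteq> {z. \<bar>Im z\<bar> * cos a \<le> Re z * sin a}"
proof (rule closure_minimal)
  show "closed {z. \<bar>Im z\<bar> * cos a \<le> Re z * sin a}"
    by (intro closed_Collect_le continuous_intros)
qed (auto simp: sector_iff_sin[OF assms])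

lemma open_left_shift:
  assumes "open U" "w \<in> U"
  obtains \<eta> where "\<eta> > 0" "w - complex_of_real \<eta> \<in> U"
proof -
  obtain e where e: "e > 0" "ball w e \<subseteq> U" using assms openE by blast
  then have "w - complex_of_real (e / 2) \<in> ball w e" by (simp add: dist_norm norm_divide)
  then have "w - complex_of_real (e / 2) \<in> U" using e by blast
  then show ?thesis using e by (intro that[of "e / 2"]) auto
qed

text \<open>Points that are approximated, up to \<open>o(t)\<close> after scaling by \<open>t\<close>, by points
  omitted by \<open>G_dom a\<close> as \<open>t \<rightarrow> \<infinity>\<close>.\<close>

definition asymptotic_complement :: "real \<Rightarrow> complex set" where
  "asymptotic_complement a =
     (if a = pi then {w. Im w = 0 \<and> Re w < 0} else {w. Re w * sin a < \<bar>Im w\<bar> * cos a})"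

text \<open>The witness is the rounding of \<open>t * p\<close>. For \<open>a < pi\<close> the
  target is an open cone, so rounded points eventually enter it; for \<open>a = pi\<close> rounding
  keeps the point on the negative axis, because the zero imaginary part rounds to 0.\<close>

lemma asymptotic_complement_approx:
  assumes a: "0 < a" "a \<le> pi" and p: "p \<in> asymptotic_complement a"
  obtains e :: "real \<Rightarrow> complex"
  where "\<forall>\<^sub>F t in at_top. e t \<notin> G_dom a" "((\<lambda>t. e t / of_real t) \<longlongrightarrow> p) at_top"
proof -
  define e where "e = (\<lambda>t. Complex (of_int \<lfloor>t * Re p\<rfloor>) (of_int \<lfloor>t * Im p\<rfloor>))"
  have lim: "((\<lambda>t. e t / of_real t) \<longlongrightarrow> p) at_top" unfolding e_def by (rule floor_rounding_tendsto)
  have "\<forall>\<^sub>F t in at_top. e t \<notin> G_dom a"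
  proof (cases "a = pi")
    case True
    show ?thesis
      using eventually_gt_at_top[of 0]
    proof eventually_elim
      case (elim t)
      define n where "n = nat (- \<lfloor>t * Re p\<rfloor>)"
      have pr: "Im p = 0" "Re p < 0" using p True by (auto simp: asymptotic_complement_def)
      have "t * Re p < 0" using pr elim by (simp add: mult_pos_neg)
      \<comment> \<open>Rounding down rather than to the nearest integer avoids 0, which belongs to
        \<open>G_dom pi\<close>.\<close>
      then have "\<lfloor>t * Re p\<rfloor> \<le> -1" by linarith
      then have "n \<ge> 1" "of_int \<lfloor>t * Re p\<rfloor> = - real n" by (auto simp: n_def)
      then have "e t = - of_nat n" using pr by (simp add: e_def complex_eq_iff)
      then show ?case using \<open>n \<ge> 1\<close> True by (auto simp: G_dom_def)
    qed
  next
    case False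
    then have a': "0 < a" "a < pi" using a by auto
    define T where "T = {w. Re w * sin a < \<bar>Im w\<bar> * cos a}"
    have T: "p \<in> T" using p False by (simp add: T_def asymptotic_complement_def)
    have "open T" unfolding T_def by (intro open_Collect_less continuous_intros)
    then have "\<forall>\<^sub>F t in at_top. e t / of_real t \<in> T" using topological_tendstoD[OF lim _ T] by blast
    then show ?thesis
      using eventually_gt_at_top[of 0]
    proof eventually_elim
      case (elim t)
      \<comment> \<open>\<open>T\<close> is a cone, so the positive factor \<open>t\<close> can be
        removed.\<close>
      then have "e t \<in> T" by (simp add: T_def divide_right_mono field_simps)
      then have "e t \<notin> closure (sector a)" using closure_sector_subset[OF a'] by (auto simp: T_def)
      moreover have "e t \<in> gauss_lattice" by (auto simp: gauss_lattice_def e_def)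
      ultimately show ?case using False by (simp add: G_dom_def E_set_def)
    qed
  qed
  with lim show ?thesis using that by blast
qed

text \<open>An open set cannot touch the boundary of the (slit) sector from inside: shifting a boundary
  point to the left lands in the asymptotic complement.\<close>

lemma open_avoiding_asymptotic_complement:
  assumes a: "0 < a" "a \<le> pi"
    and U: "open U" "U \<inter> asymptotic_complement a = {}" "w \<in> U"
  shows "w \<notin> \<real>\<^sub>\<le>\<^sub>0 \<and> \<bar>Im (Ln w)\<bar> < a"
proof -
  obtain \<eta> where \<eta>: "\<eta> > 0" "w - complex_of_real \<eta> \<in> U" using open_left_shift[OF U(1,3)] .
  have shift: "w - complex_of_real \<eta> \<notin> asymptotic_complement a" using \<eta> U by blast
  show ?thesis
  proof (cases "a = pi")
    case True
    then have w: "w \<notin> \<real>\<^sub>\<le>\<^sub>0"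
      using shift \<eta> by (auto simp: asymptotic_complement_def complex_nonpos_Reals_iff)
    then have nz: "w \<noteq> 0" by auto
    have "Im (Ln w) \<noteq> pi" using w nz Im_Ln_eq_pi by (auto simp: complex_nonpos_Reals_iff)
    then show ?thesis
      using w mpi_less_Im_Ln[OF nz] Im_Ln_le_pi[OF nz] True by auto
  next
    case False
    then have a': "0 < a" "a < pi" using a by auto
    have "\<bar>Im w\<bar> * cos a \<le> (Re w - \<eta>) * sin a"
      using shift False by (simp add: asymptotic_complement_def)
    also have "\<dots> < Re w * sin a" using \<eta> sin_gt_zero[OF a'] by simp
    finally show ?thesis
      using sector_iff_sin[OF a'] sector_iff_Ln[OF a'] by blast
  qed
qed

section \<open>The two bounds for the domain\<close>

lemma bergman_number_G_dom_ge:
  assumes a: "0 < a" "a \<le> pi" and f: "f \<in> Hol_disc (G_dom a)"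
  shows "ereal (pi / (2 * a)) \<le> bergman_number f"
proof -
  have holf: "f holomorphic_on ball 0 1" using f by (simp add: Hol_disc_def)
  have *: "ereal v \<le> bergman_number f" if v: "0 < v" "v < pi / (2 * a)" for v
  proof -
    \<comment> \<open>Then \<open>v < pi / (2 * a)\<close> becomes \<open>c > 4 * a / pi\<close>,
      and the growth exponent \<open>c / 2\<close> is \<open>1 / v\<close>.\<close>
    define c where "c = 2 / v"
    have "v * (4 * a) < pi * 2" using v a by (simp add: field_simps)
    then have c: "c > 4 * a / pi" "c > 0" using v by (auto simp: c_def field_simps)
    \<comment> \<open>Two distinct limits of omitted points, as Schottky requires; the negative axis
      works for every \<open>a\<close>.\<close>
    have neg: "-1 \<in> asymptotic_complement a" "-2 \<in> asymptotic_complement a" "(-1::complex) \<noteq> -2"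
      using a sin_gt_zero[of a] by (auto simp: asymptotic_complement_def)
    obtain R where R: "R > 0" and
      bd: "\<And>f. \<lbrakk>f \<in> Hol_disc (G_dom a); cmod (f 0) \<ge> R\<rbrakk> \<Longrightarrow> cmod (deriv f 0) \<le> c * cmod (f 0)"
    proof (rule deriv_bound_far[where G = "G_dom a" and T = "asymptotic_complement a", OF a(1) c(1) _ neg])
      show "\<exists>e :: real \<Rightarrow> complex. (\<forall>\<^sub>F t in at_top. e t \<notin> G_dom a) \<and> ((\<lambda>t. e t / of_real t) \<longlongrightarrow> p) at_top"
        if "p \<in> asymptotic_complement a" for p
        using asymptotic_complement_approx[OF a that] by blast
      show "w \<notin> \<real>\<^sub>\<le>\<^sub>0 \<and> \<bar>Im (Ln w)\<bar> < a"
        if "open U" "U \<inter> asymptotic_complement a = {}" "w \<in> U" for U w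
        using open_avoiding_asymptotic_complement[OF a that] .
    qed (use that in blast)
    show ?thesis
    proof (rule bergman_number_ge_of_growth[OF holf v(1)])
      fix z :: complex assume z: "z \<in> ball 0 1"
      define M where "M = max R (cmod (f 0))"
      have "cmod (f z) \<le> M * ((1 + cmod z) / (1 - cmod z)) powr (c / 2)"
        unfolding M_def
        by (rule growth_of_deriv_bound[OF holf R c(2) deriv_bound_disc[OF f _ _ bd] z])
      also have "\<dots> \<le> M * (2 / (1 - cmod z)) powr (c / 2)"
        using z c R by (intro mult_left_mono powr_mono2 divide_right_mono) (auto simp: M_def)
      also have "\<dots> = M * 2 powr (1 / v) * (1 - cmod z) powr (- (1 / v))"
        using z by (simp add: powr_divide powr_minus c_def field_simps)
      finally show "cmod (f z) \<le> M * 2 powr (1 / v) * (1 - cmod z) powr (- (1 / v))" .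
    qed
  qed
  then show ?thesis by (rule bergman_number_geI)
qed

text \<open>The exponent is chosen so that \<open>k * (pi / 2) = a\<close>: arguments in the right
  half-plane are scaled to arguments below \<open>a\<close> in modulus.\<close>

lemma cusp_power_in_Hol_disc:
  assumes a: "0 < a" "a \<le> pi"
  shows "cusp_power (2 * a / pi) \<in> Hol_disc (G_dom a)"
proof -
  define k where "k = 2 * a / pi"
  have k: "0 < k" "k \<le> 2" "k * (pi / 2) = a" using a by (auto simp: k_def field_simps)
  have "cusp_power k z \<in> G_dom a" if z: "z \<in> ball 0 1" for z
  proof -
    have nz: "cusp_power k z \<noteq> 0" using Ln_cusp_power(1)[OF z] k by simp
    have "\<bar>Im (Ln (cusp_power k z))\<bar> = k * \<bar>Im (Ln (1 - z))\<bar>"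
      using Ln_cusp_power(2)[OF z] k by (simp add: abs_mult)
    also have "\<dots> < k * (pi / 2)"
      using Ln_cusp_power(3)[OF z, of k] k by (intro mult_strict_left_mono) auto
    finally have arg: "\<bar>Im (Ln (cusp_power k z))\<bar> < a" using k by simp
    have slit: "cusp_power k z \<notin> \<real>\<^sub>\<le>\<^sub>0"
      using arg a nz Im_Ln_eq_pi[OF nz] by (auto simp: complex_nonpos_Reals_iff complex_eq_iff)
    show ?thesis
    proof (cases "a = pi")
      case True
      then show ?thesis using slit by (auto simp: G_dom_def)
    next
      case False
      then have "cusp_power k z \<in> sector a" using arg slit sector_iff_Ln a by simp
      then show ?thesis using False closure_subset by (auto simp: G_dom_def E_set_def)
    qed
  qed
  then show ?thesis using holomorphic_cusp_power by (auto simp: Hol_disc_def k_def)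
qed

theorem theorem1p3:
  fixes a :: real
  assumes "0 < a" and "a \<le> pi"
  shows "domain_bergman_number (G_dom a) = ereal (pi / (2 * a))"
proof (rule antisym)
  have "domain_bergman_number (G_dom a) \<le> bergman_number (cusp_power (2 * a / pi))"
    unfolding domain_bergman_number_def
    using cusp_power_in_Hol_disc[OF assms] by (intro Inf_lower) blast
  also have "\<dots> \<le> ereal (1 / (2 * a / pi))"
    using assms by (intro bergman_number_cusp_power) simp
  finally show "domain_bergman_number (G_dom a) \<le> ereal (pi / (2 * a))" by simp
  show "ereal (pi / (2 * a)) \<le> domain_bergman_number (G_dom a)"
    unfolding domain_bergman_number_def
    using bergman_number_G_dom_ge[OF assms] by (intro Inf_greatest) blast
qed

end
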